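(* Let $N=2^{d_1+1}$ and, for an operator $\Phi$ on $\mathbb C^N$, let $\mathcal T(\Phi)=\frac{1}{N!}\sum_{\sigma\in\mathrm{Sym}(N)}U_\sigma\Phi U_\sigma^\dagger$, where $U_\sigma$ is the permutation matrix of $\sigma$. In the setting of the context: (i) Averaging over a uniformly random key $k\in\{0,1\}^{2d_1}$ and a uniformly random permutation $\sigma$, the original ciphertext has expectation $\mathbb E_{\sigma,k}[M_f^{(0)}]=\frac{1}{2^{d_1+1}}I_{2^{d_1+1}}$. (ii) Let $\overline{M}_a^{(1)}$ denote $M_a^{(1)}$ with $M_o'$ replaced by $\mathbb E_k[M_o']=2^{-d_1}I_{2^{d_1}}$ and $M_c''$ replaced by $\mathbb E_{k'}[M_c'']=2^{-d_2}VV^\dagger$ (keys uniform). Then \[ \mathcal T\big(\overline{M}_a^{(1)}\big)=\frac{2^{d_1+1}-1-\frac2\eta}{2^{d_1+1}(2^{d_1+1}-1)}\,I+\frac{2/\eta}{2^{d_1+1}(2^{d_1+1}-1)}\,J, \] where $J$ is the $N\times N$ all-ones matrix. (iii) The trace distance between the averaged states in (ii) and (i) equals $\frac{1}{\eta\,2^{d_1}}$, which is less than $\varepsilon$. (iv) For any two input pairs $(M_o,M_c)$ and $(\tilde M_o,\tilde M_c)$ of the same dimensions, the averaged anamorphic states obtained as in (ii) (all keys drawn uniformly from the same key sets) have trace distance $0$.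
   Context: Let $d_1\ge d_2\ge1$, $\mathcal H_M=(\mathbb C^2)^{\otimes d_1}$, $\mathcal H_{M_c}=(\mathbb C^2)^{\otimes d_2}$, and $U_k=\bigotimes_{j}X^{k_{2j-1}}Z^{k_{2j}}$ (Pauli $X,Z$) for bit strings $k$. $M_o$ is a strictly positive definite density matrix on $\mathcal H_M$, $M_c$ a density matrix on $\mathcal H_{M_c}$; $M_o'=U_kM_oU_k^\dagger$ with $k\in\{0,1\}^{2d_1}$, $M_c'=U_{k'}M_cU_{k'}^\dagger$ with $k'\in\{0,1\}^{2d_2}$, $V|\psi\rangle=|\psi\rangle\otimes|0\rangle^{\otimes(d_1-d_2)}$, $M_c''=VM_c'V^\dagger$. For $\eta\in\mathbb Z^+$, on $\mathbb C^2\otimes\mathcal H_M$ (blocks w.r.t. the first qubit), $M_a^{(0)}=\begin{pmatrix}\frac12M_o'&0\\0&\frac12M_o'\end{pmatrix}$, $M_a^{(1)}=\begin{pmatrix}\frac12M_o'&\frac1\eta M_c''\\\frac1\eta(M_c'')^\dagger&\frac12M_o'\end{pmatrix}$, and $M_f^{(b)}=U_\sigma M_a^{(b)}U_\sigma^\dagger$ for a permutation $\sigma\in\mathrm{Sym}(2^{d_1+1})$. Standing assumption of the construction: for a given threshold $\varepsilon>0$ (written $\mathsf{negl}(\lambda)$), $\eta$ satisfies $1/\eta<\varepsilon$ and $\frac1{\eta^2}\|M_c''(M_o')^{-1}M_c''\|\le\frac14\lambda_{\min}(M_o')$. Trace distance $D(\rho,\tau)=\frac12\|\rho-\tau\|_1$.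 *)

theory Defs
  imports "Jordan_Normal_Form.Jordan_Normal_Form" "Jordan_Normal_Form.Schur_Decomposition"
          "HOL-Combinatorics.Permutations"
begin

definition mtrace :: "complex mat \<Rightarrow> complex" where
  "mtrace A = (\<Sum>i<dim_row A. A $$ (i,i))"

text \<open>Kronecker (tensor) product; the left factor carries the most significant index.\<close>
definition kron :: "complex mat \<Rightarrow> complex mat \<Rightarrow> complex mat" where
  "kron A B = mat (dim_row A * dim_row B) (dim_col A * dim_col B)
     (\<lambda>(i,j). A $$ (i div dim_row B, j div dim_col B) * B $$ (i mod dim_row B, j mod dim_col B))"

definition conj_by :: "complex mat \<Rightarrow> complex mat \<Rightarrow> complex mat" where
  "conj_by U A = U * A * mat_adjoint U"

definition msum :: "nat \<Rightarrow> nat \<Rightarrow> 'k set \<Rightarrow> ('k \<Rightarrow> complex mat) \<Rightarrow> complex mat" where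
  "msum nr nc S f = mat nr nc (\<lambda>ij. \<Sum>x\<in>S. f x $$ ij)"

definition mexp :: "nat \<Rightarrow> nat \<Rightarrow> 'k set \<Rightarrow> ('k \<Rightarrow> complex mat) \<Rightarrow> complex mat" where
  "mexp nr nc S f = (1 / of_nat (card S)) \<cdot>\<^sub>m msum nr nc S f"

definition hermitian :: "complex mat \<Rightarrow> bool" where
  "hermitian A \<longleftrightarrow> A = mat_adjoint A"

definition density_matrix :: "nat \<Rightarrow> complex mat \<Rightarrow> bool" where
  "density_matrix n A \<longleftrightarrow> A \<in> carrier_mat n n \<and> hermitian A
     \<and> (\<forall>v \<in> carrier_vec n. 0 \<le> Re (v \<bullet>c (A *\<^sub>v v))) \<and> mtrace A = 1"

definition strictly_pos_def :: "nat \<Rightarrow> complex mat \<Rightarrow> bool" where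
  "strictly_pos_def n A \<longleftrightarrow> A \<in> carrier_mat n n \<and> hermitian A
     \<and> (\<forall>v \<in> carrier_vec n. v \<noteq> 0\<^sub>v n \<longrightarrow> 0 < Re (v \<bullet>c (A *\<^sub>v v)))"

definition eigvals :: "complex mat \<Rightarrow> complex multiset" where
  "eigvals A = proots (char_poly A)"

definition lambda_min :: "complex mat \<Rightarrow> real" where
  "lambda_min A = Min (Re ` set_mset (eigvals A))"

definition op_norm :: "complex mat \<Rightarrow> real" where
  "op_norm A = Max (sqrt ` Re ` set_mset (eigvals (mat_adjoint A * A)))"

definition trace_norm :: "complex mat \<Rightarrow> real" where
  "trace_norm A = (\<Sum>s \<in># eigvals (mat_adjoint A * A). sqrt (Re s))"

definition trace_dist :: "complex mat \<Rightarrow> complex mat \<Rightarrow> real" where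
  "trace_dist \<rho> \<tau> = trace_norm (\<rho> - \<tau>) / 2"

definition all_ones :: "nat \<Rightarrow> complex mat" where
  "all_ones n = mat n n (\<lambda>_. 1)"

definition pauliX :: "complex mat" where
  "pauliX = mat_of_rows_list 2 [[0,1],[1,0]]"

definition pauliZ :: "complex mat" where
  "pauliZ = mat_of_rows_list 2 [[1,0],[0,-1]]"

fun pauli_key :: "bool list \<Rightarrow> complex mat" where
  "pauli_key (a # b # r) =
     kron ((if a then pauliX else 1\<^sub>m 2) * (if b then pauliZ else 1\<^sub>m 2)) (pauli_key r)"
| "pauli_key _ = 1\<^sub>m 1"

definition keys :: "nat \<Rightarrow> bool list set" where
  "keys d = {k. length k = 2 * d}"

definition ket0 :: "nat \<Rightarrow> complex mat" where
  "ket0 m = mat m 1 (\<lambda>(i,j). if i = 0 then 1 else 0)"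

text \<open>V |psi> = |psi> (x) |0>^(d1-d2), as a 2^d1 x 2^d2 matrix.\<close>
definition isoV :: "nat \<Rightarrow> nat \<Rightarrow> complex mat" where
  "isoV d1 d2 = kron (1\<^sub>m (2 ^ d2)) (ket0 (2 ^ (d1 - d2)))"

definition perm_mat :: "nat \<Rightarrow> (nat \<Rightarrow> nat) \<Rightarrow> complex mat" where
  "perm_mat N \<sigma> = mat N N (\<lambda>(i,j). if i = \<sigma> j then 1 else 0)"

definition Sym :: "nat \<Rightarrow> (nat \<Rightarrow> nat) set" where
  "Sym N = {\<sigma>. \<sigma> permutes {..<N}}"

definition twirl :: "nat \<Rightarrow> complex mat \<Rightarrow> complex mat" where
  "twirl N \<Phi> = (1 / of_nat (fact N)) \<cdot>\<^sub>m msum N N (Sym N) (\<lambda>\<sigma>. conj_by (perm_mat N \<sigma>) \<Phi>)"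

definition Mo_key :: "complex mat \<Rightarrow> bool list \<Rightarrow> complex mat" where
  "Mo_key Mo k = conj_by (pauli_key k) Mo"

definition Mc_key :: "nat \<Rightarrow> nat \<Rightarrow> complex mat \<Rightarrow> bool list \<Rightarrow> complex mat" where
  "Mc_key d1 d2 Mc k' = conj_by (isoV d1 d2) (conj_by (pauli_key k') Mc)"

definition Ma0 :: "complex mat \<Rightarrow> complex mat" where
  "Ma0 Mo' = four_block_mat ((1/2) \<cdot>\<^sub>m Mo') (0\<^sub>m (dim_row Mo') (dim_col Mo'))
                            (0\<^sub>m (dim_row Mo') (dim_col Mo')) ((1/2) \<cdot>\<^sub>m Mo')"

definition Ma1 :: "nat \<Rightarrow> complex mat \<Rightarrow> complex mat \<Rightarrow> complex mat" where
  "Ma1 \<eta> Mo' Mc'' = four_block_mat ((1/2) \<cdot>\<^sub>m Mo') ((1 / of_nat \<eta>) \<cdot>\<^sub>m Mc'')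
                            ((1 / of_nat \<eta>) \<cdot>\<^sub>m mat_adjoint Mc'') ((1/2) \<cdot>\<^sub>m Mo')"

definition Mf :: "nat \<Rightarrow> (nat \<Rightarrow> nat) \<Rightarrow> complex mat \<Rightarrow> complex mat" where
  "Mf N \<sigma> Ma = conj_by (perm_mat N \<sigma>) Ma"

definition Ma1_bar :: "nat \<Rightarrow> nat \<Rightarrow> nat \<Rightarrow> complex mat \<Rightarrow> complex mat \<Rightarrow> complex mat" where
  "Ma1_bar d1 d2 \<eta> Mo Mc = Ma1 \<eta> (mexp (2^d1) (2^d1) (keys d1) (Mo_key Mo))
                                 (mexp (2^d1) (2^d1) (keys d2) (Mc_key d1 d2 Mc))"

definition standing_assm :: "nat \<Rightarrow> nat \<Rightarrow> nat \<Rightarrow> real \<Rightarrow> complex mat \<Rightarrow> complex mat \<Rightarrow> bool" where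
  "standing_assm d1 d2 \<eta> \<epsilon> Mo Mc \<longleftrightarrow> 1 / real \<eta> < \<epsilon> \<and>
     (\<forall>k\<in>keys d1. \<forall>k'\<in>keys d2.
        (1 / (real \<eta>)^2) * op_norm (Mc_key d1 d2 Mc k' * the (mat_inverse (Mo_key Mo k)) * Mc_key d1 d2 Mc k')
          \<le> lambda_min (Mo_key Mo k) / 4)"

end

theory Submission
  imports Defs
begin

text \<open>The entries of the Pauli strings satisfy an orthogonality relation, proved by splitting off the
  first qubit; hence averaging over the keys sends a density matrix to the maximally mixed state.
  Twirling over all permutations keeps only the trace and the sum of all entries. For the key-averaged
  anamorphic state these are 1 and 1 + 2/\<eta>, the excess coming from the two off-diagonal blocks,
  since each column of V has a single entry 1. The trace norms are read off from the spectrum of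
  aI + bJ.\<close>

text \<open>The averaged states depend on the inputs only through their traces, which are 1; so (iv)
  compares a matrix with itself. The twirled state differs from I/N by b(J - I) with b = (2/\<eta>)
  / (N(N - 1)): the excess 2/\<eta> of the entry sum over the trace is spread evenly over the N(N -
  1) off-diagonal positions. This difference has eigenvalue (N - 1)b once and -b with multiplicity N
  - 1, so half its trace norm is (N - 1)b = 2/(\<eta> N) = 1/(\<eta> 2^d1). As
  \<open>trace_norm\<close> sums over a multiset of eigenvalues, multiplicities matter; this is why
  aI + bJ is brought to triangular form rather than merely tested on eigenvectors.\<close>

section \<open>Entries of adjoints, conjugations and averages\<close>

lemma dim_mat_adjoint [simp]:
  "dim_row (mat_adjoint A) = dim_col A" "dim_col (mat_adjoint A) = dim_row A"
  by (auto simp: mat_adjoint_def)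

lemma index_mat_adjoint [simp]:
  fixes A :: "complex mat"
  assumes "i < dim_col A" "j < dim_row A"
  shows "mat_adjoint A $$ (i, j) = cnj (A $$ (j, i))"
  using assms by (simp add: mat_adjoint_def mat_of_rows_index)

lemma index_mult_mat_sum:
  assumes "A \<in> carrier_mat m n" "B \<in> carrier_mat n l" "i < m" "j < l"
  shows "(A * B) $$ (i, j) = (\<Sum>k<n. A $$ (i, k) * B $$ (k, j))"
  using assms by (auto simp: scalar_prod_def lessThan_atLeast0 intro!: sum.cong)

lemma conj_by_carrier [simp]:
  assumes "W \<in> carrier_mat m n"
  shows "conj_by W A \<in> carrier_mat m m"
  using assms unfolding conj_by_def by (intro carrier_matI) auto

lemma index_conj_by:
  assumes W: "W \<in> carrier_mat m n" and A: "A \<in> carrier_mat n n" and ij: "i < m" "j < m"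
  shows "conj_by W A $$ (i, j) = (\<Sum>p<n. \<Sum>q<n. W $$ (i, p) * A $$ (p, q) * cnj (W $$ (j, q)))"
proof -
  have adj: "mat_adjoint W \<in> carrier_mat n m" using W by auto
  have "conj_by W A $$ (i, j) = (\<Sum>q<n. (W * A) $$ (i, q) * mat_adjoint W $$ (q, j))"
    unfolding conj_by_def using index_mult_mat_sum[OF mult_carrier_mat[OF W A] adj] ij by simp
  also have "\<dots> = (\<Sum>q<n. \<Sum>p<n. W $$ (i, p) * A $$ (p, q) * cnj (W $$ (j, q)))"
    using W ij by (intro sum.cong) (auto simp: index_mult_mat_sum[OF W A] sum_distrib_right)
  also have "\<dots> = (\<Sum>p<n. \<Sum>q<n. W $$ (i, p) * A $$ (p, q) * cnj (W $$ (j, q)))"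
    by (rule sum.swap)
  finally show ?thesis .
qed

lemma mexp_carrier [simp]: "mexp m n S f \<in> carrier_mat m n"
  by (simp add: mexp_def msum_def)

lemma dim_mexp [simp]: "dim_row (mexp m n S f) = m" "dim_col (mexp m n S f) = n"
  by (simp_all add: mexp_def msum_def)

lemma index_mexp [simp]:
  assumes "i < m" "j < n"
  shows "mexp m n S f $$ (i, j) = (\<Sum>x\<in>S. f x $$ (i, j)) / of_nat (card S)"
  using assms by (simp add: mexp_def msum_def)

lemma mexp_cong:
  assumes "\<And>x. x \<in> S \<Longrightarrow> f x = g x"
  shows "mexp m n S f = mexp m n S g"
  using assms by (intro eq_matI) auto

text \<open>Conjugation is linear in the conjugated matrix. With W a permutation matrix or the
  isometry V, this moves the key average inside.\<close>

lemma mexp_conj_by: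
  assumes W: "W \<in> carrier_mat m n" and f: "\<And>x. x \<in> S \<Longrightarrow> f x \<in> carrier_mat n n"
  shows "mexp m m S (\<lambda>x. conj_by W (f x)) = conj_by W (mexp n n S f)"
proof (rule eq_matI)
  fix i j assume "i < dim_row (conj_by W (mexp n n S f))" "j < dim_col (conj_by W (mexp n n S f))"
  then have ij: "i < m" "j < m" using W by (auto simp: conj_by_def)
  have "(\<Sum>x\<in>S. conj_by W (f x) $$ (i, j))
      = (\<Sum>x\<in>S. \<Sum>p<n. \<Sum>q<n. W $$ (i, p) * f x $$ (p, q) * cnj (W $$ (j, q)))"
    using index_conj_by[OF W f ij] by simp
  also have "\<dots> = (\<Sum>p<n. \<Sum>q<n. \<Sum>x\<in>S. W $$ (i, p) * f x $$ (p, q) * cnj (W $$ (j, q)))"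
    by (subst sum.swap, intro sum.cong refl, rule sum.swap)
  finally show "mexp m m S (\<lambda>x. conj_by W (f x)) $$ (i, j) = conj_by W (mexp n n S f) $$ (i, j)"
    using ij by (simp add: index_conj_by[OF W mexp_carrier] sum_divide_distrib
        sum_distrib_left sum_distrib_right)
qed (use W in \<open>auto simp: conj_by_def\<close>)

lemma mexp_Times:
  assumes "finite S" "finite K"
  shows "mexp m n (S \<times> K) (\<lambda>(s, k). f s k) = mexp m n S (\<lambda>s. mexp m n K (f s))"
  by (rule eq_matI)
     (auto simp: sum.cartesian_product card_cartesian_product case_prod_unfold
       sum_divide_distrib[symmetric] mult.commute)

section \<open>Averaging over Pauli keys\<close>

lemma pauli_key_carrier:
  "length k = 2 * d \<Longrightarrow> pauli_key k \<in> carrier_mat (2 ^ d) (2 ^ d)"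
proof (induction k arbitrary: d rule: pauli_key.induct)
  case (1 a b r)
  then obtain e where d: "d = Suc e" by (cases d) auto
  have "pauli_key r \<in> carrier_mat (2 ^ e) (2 ^ e)" using 1 d by simp
  moreover have "pauliX \<in> carrier_mat 2 2" "pauliZ \<in> carrier_mat 2 2"
    by (auto simp: pauliX_def pauliZ_def mat_of_rows_list_def)
  ultimately show ?case by (auto simp: d kron_def)
qed auto

lemma keys_Suc: "keys (Suc d) = (\<lambda>(a, b, r). a # b # r) ` (UNIV \<times> UNIV \<times> keys d)"
proof (intro equalityI subsetI)
  fix k assume "k \<in> keys (Suc d)"
  then have "length k = Suc (Suc (2 * d))" by (simp add: keys_def)
  then obtain a b r where "k = a # b # r" "length r = 2 * d" by (auto simp: length_Suc_conv)
  then show "k \<in> (\<lambda>(a, b, r). a # b # r) ` (UNIV \<times> UNIV \<times> keys d)"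
    by (auto simp: keys_def image_iff)
qed (auto simp: keys_def)

lemma finite_keys: "finite (keys d)"
  using finite_lists_length_eq[of "UNIV :: bool set" "2 * d"] by (simp add: keys_def)

lemma card_keys: "card (keys d) = 4 ^ d"
  using card_lists_length_eq[of "UNIV :: bool set" "2 * d"] by (simp add: keys_def power_mult)

text \<open>A name for the one-qubit factor X^a Z^b that \<open>pauli_key\<close> builds in
  place.\<close>

definition pauli1 :: "bool \<Rightarrow> bool \<Rightarrow> complex mat" where
  "pauli1 a b = (if a then pauliX else 1\<^sub>m 2) * (if b then pauliZ else 1\<^sub>m 2)"

text \<open>X^a Z^b sends the basis vector p to (-1)^(bp) times the basis vector p xor a; the test
  \<open>(i = p) \<noteq> a\<close> says i = p xor a.\<close>

lemma pauli1_index: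
  assumes "i < 2" "p < 2"
  shows "pauli1 a b $$ (i, p) = (if (i = p) \<noteq> a then if b \<and> p = 1 then - 1 else 1 else 0)"
proof -
  have "i = 0 \<or> i = 1" "p = 0 \<or> p = 1" using assms by auto
  then show ?thesis
    by (cases a; cases b)
       (auto simp: pauli1_def pauliX_def pauliZ_def mat_of_rows_list_def scalar_prod_def
         numeral_2_eq_2)
qed

text \<open>A nonzero term needs a = i xor p = j xor q. The sum over b of the signs (-1)^(b(p + q))
  is 2 if p = q and 0 otherwise, and p = q then forces i = j.\<close>

lemma pauli1_orthogonal:
  assumes "i < 2" "j < 2" "p < 2" "q < 2"
  shows "(\<Sum>a\<in>UNIV. \<Sum>b\<in>UNIV. pauli1 a b $$ (i, p) * cnj (pauli1 a b $$ (j, q)))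
       = (if i = j \<and> p = q then 2 else 0)"
proof -
  have "i = 0 \<or> i = 1" "p = 0 \<or> p = 1" "j = 0 \<or> j = 1" "q = 0 \<or> q = 1" using assms by auto
  then show ?thesis
    using assms by (auto simp: UNIV_bool pauli1_index)
qed

lemma pauli_key_Cons_index:
  assumes r: "r \<in> keys d" and ip: "i < 2 ^ Suc d" "p < 2 ^ Suc d"
  shows "pauli_key (a # b # r) $$ (i, p)
       = pauli1 a b $$ (i div 2 ^ d, p div 2 ^ d) * pauli_key r $$ (i mod 2 ^ d, p mod 2 ^ d)"
proof -
  have "pauli_key r \<in> carrier_mat (2 ^ d) (2 ^ d)"
    using r pauli_key_carrier by (simp add: keys_def)
  moreover have "pauliX \<in> carrier_mat 2 2" "pauliZ \<in> carrier_mat 2 2"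
    by (auto simp: pauliX_def pauliZ_def mat_of_rows_list_def)
  ultimately show ?thesis
    using ip by (auto simp: kron_def pauli1_def)
qed

lemma pauli_key_orthogonal:
  assumes "i < 2 ^ d" "j < 2 ^ d" "p < 2 ^ d" "q < 2 ^ d"
  shows "(\<Sum>k\<in>keys d. pauli_key k $$ (i, p) * cnj (pauli_key k $$ (j, q)))
       = (if i = j \<and> p = q then 2 ^ d else 0)"
  using assms
proof (induction d arbitrary: i j p q)
  case 0
  then show ?case by (auto simp: keys_def)
next
  case (Suc d)
  let ?n = "2 ^ d :: nat"
  let ?f = "\<lambda>k. pauli_key k $$ (i, p) * cnj (pauli_key k $$ (j, q))"
  let ?g = "\<lambda>a b. pauli1 a b $$ (i div ?n, p div ?n) * cnj (pauli1 a b $$ (j div ?n, q div ?n))"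
  let ?h = "\<lambda>r. pauli_key r $$ (i mod ?n, p mod ?n) * cnj (pauli_key r $$ (j mod ?n, q mod ?n))"
  have inj: "inj_on (\<lambda>(a, b, r). a # b # r) (UNIV \<times> UNIV \<times> keys d)"
    by (auto simp: inj_on_def)
  have "(\<Sum>k\<in>keys (Suc d). ?f k) = (\<Sum>(a, b, r)\<in>UNIV \<times> UNIV \<times> keys d. ?f (a # b # r))"
    unfolding keys_Suc by (subst sum.reindex[OF inj]) (simp add: case_prod_unfold)
  also have "\<dots> = (\<Sum>(a, b, r)\<in>UNIV \<times> UNIV \<times> keys d. ?g a b * ?h r)"
    using Suc.prems by (intro sum.cong refl) (auto simp: pauli_key_Cons_index mult_ac simp del: pauli_key.simps)
  \<comment> \<open>The bits a, b of the first qubit and the remaining key r vary independently, so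
    the sum factorises.\<close>
  also have "\<dots> = (\<Sum>a\<in>UNIV. \<Sum>b\<in>UNIV. ?g a b) * (\<Sum>r\<in>keys d. ?h r)"
    unfolding sum_distrib_right by (simp add: sum.cartesian_product[symmetric] sum_distrib_left)
  also have "(\<Sum>r\<in>keys d. ?h r)
      = (if i mod ?n = j mod ?n \<and> p mod ?n = q mod ?n then 2 ^ d else 0)"
    by (rule Suc.IH) auto
  also have "(\<Sum>a\<in>UNIV. \<Sum>b\<in>UNIV. ?g a b)
      = (if i div ?n = j div ?n \<and> p div ?n = q div ?n then 2 else 0)"
    using Suc.prems by (intro pauli1_orthogonal) (auto simp: less_mult_imp_div_less)
  finally have sum: "(\<Sum>k\<in>keys (Suc d). ?f k)
      = (if (i div ?n = j div ?n \<and> i mod ?n = j mod ?n) \<and> (p div ?n = q div ?n \<and> p mod ?n = q mod ?n)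
         then 2 ^ Suc d else 0)"
    by simp
  \<comment> \<open>Quotient and remainder by 2^d are the first-qubit part and the rest of an index;
    together they determine it, so the two conditions merge into
    \<open>i = j \<and> p = q\<close>.\<close>
  have eq: "x = y \<longleftrightarrow> x div ?n = y div ?n \<and> x mod ?n = y mod ?n" for x y :: nat
    by (metis div_mult_mod_eq)
  show ?case unfolding sum by (simp only: eq[of i j] eq[of p q])
qed

text \<open>Orthogonality collapses the double sum over p and q to the diagonal, which leaves the
  trace of A when i = j and nothing otherwise.\<close>

lemma pauli_twirl:
  assumes A: "A \<in> carrier_mat (2 ^ d) (2 ^ d)"
  shows "mexp (2 ^ d) (2 ^ d) (keys d) (\<lambda>k. conj_by (pauli_key k) A)
       = (mtrace A / 2 ^ d) \<cdot>\<^sub>m 1\<^sub>m (2 ^ d)"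
proof (rule eq_matI)
  let ?n = "2 ^ d :: nat"
  fix i j assume "i < dim_row ((mtrace A / 2 ^ d) \<cdot>\<^sub>m 1\<^sub>m ?n)" "j < dim_col ((mtrace A / 2 ^ d) \<cdot>\<^sub>m 1\<^sub>m ?n)"
  then have ij: "i < ?n" "j < ?n" by auto
  have "(\<Sum>k\<in>keys d. conj_by (pauli_key k) A $$ (i, j))
      = (\<Sum>k\<in>keys d. \<Sum>p<?n. \<Sum>q<?n. A $$ (p, q) * (pauli_key k $$ (i, p) * cnj (pauli_key k $$ (j, q))))"
    using ij by (intro sum.cong refl, subst index_conj_by[OF pauli_key_carrier A])
      (auto simp: keys_def mult_ac)
  also have "\<dots> = (\<Sum>p<?n. \<Sum>q<?n. A $$ (p, q)
      * (\<Sum>k\<in>keys d. pauli_key k $$ (i, p) * cnj (pauli_key k $$ (j, q))))"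
    unfolding sum_distrib_left by (subst sum.swap, intro sum.cong refl, rule sum.swap)
  also have "\<dots> = (\<Sum>p<?n. \<Sum>q<?n. if q = p then if i = j then A $$ (p, p) * 2 ^ d else 0 else 0)"
    using ij by (intro sum.cong refl) (auto simp: pauli_key_orthogonal)
  also have "\<dots> = (if i = j then mtrace A * 2 ^ d else 0)"
    using A by (simp add: mtrace_def sum_distrib_right)
  \<comment> \<open>The weight 2^d from orthogonality is divided by the 4^d keys, which leaves
    1/2^d.\<close>
  finally show "mexp ?n ?n (keys d) (\<lambda>k. conj_by (pauli_key k) A) $$ (i, j)
      = ((mtrace A / 2 ^ d) \<cdot>\<^sub>m 1\<^sub>m ?n) $$ (i, j)"
    using ij by (simp add: card_keys field_simps flip: power_mult_distrib)
qed auto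

section \<open>Sums over the symmetric group and the permutation twirl\<close>

text \<open>By transitivity (compose with a transposition) the sum does not depend on the point i.
  Adding it up over all points gives the left side; exchanging the sums makes each permutation
  contribute \<open>sum f A\<close>. The product form avoids division.\<close>

lemma sum_permutations_eq_one:
  fixes f :: "'a \<Rightarrow> 'b::comm_semiring_1"
  assumes A: "finite A" and i: "i \<in> A"
  shows "of_nat (card A) * (\<Sum>\<sigma>\<in>{\<sigma>. \<sigma> permutes A}. f (\<sigma> i)) = of_nat (fact (card A)) * sum f A"
proof -
  have inv: "(\<Sum>\<sigma>\<in>{\<sigma>. \<sigma> permutes A}. f (\<sigma> p)) = (\<Sum>\<sigma>\<in>{\<sigma>. \<sigma> permutes A}. f (\<sigma> i))" if "p \<in> A" for p
    using sum_permutations_compose_right[OF permutes_swap_id[OF i that], of "\<lambda>\<sigma>. f (\<sigma> i)"] by simp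
  have "of_nat (card A) * (\<Sum>\<sigma>\<in>{\<sigma>. \<sigma> permutes A}. f (\<sigma> i))
      = (\<Sum>p\<in>A. \<Sum>\<sigma>\<in>{\<sigma>. \<sigma> permutes A}. f (\<sigma> p))"
    by (simp add: inv)
  also have "\<dots> = (\<Sum>\<sigma>\<in>{\<sigma>. \<sigma> permutes A}. \<Sum>p\<in>A. f (\<sigma> p))" by (rule sum.swap)
  also have "\<dots> = (\<Sum>\<sigma>\<in>{\<sigma>. \<sigma> permutes A}. sum f A)"
  proof (rule sum.cong[OF refl])
    fix \<sigma> assume "\<sigma> \<in> {\<sigma>. \<sigma> permutes A}"
    then show "(\<Sum>p\<in>A. f (\<sigma> p)) = sum f A"
      using sum.permute[of \<sigma> A f] by (simp add: comp_def)
  qed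
  finally show ?thesis using A by (simp add: card_permutations)
qed

text \<open>Double transitivity. The first transposition takes i to p and j to some j'; the second
  takes j' to q and fixes p, since p differs from both j' and q.\<close>

lemma permutes_two_points:
  assumes "i \<in> A" "j \<in> A" "p \<in> A" "q \<in> A" "i \<noteq> j" "p \<noteq> q"
  obtains \<tau> where "\<tau> permutes A" "\<tau> i = p" "\<tau> j = q"
proof -
  define j' where "j' = transpose i p j"
  have "j' \<in> A" "j' \<noteq> p" using assms by (auto simp: j'_def transpose_def)
  then have "transpose j' q \<circ> transpose i p permutes A"
    "(transpose j' q \<circ> transpose i p) i = p" "(transpose j' q \<circ> transpose i p) j = q"
    using assms by (auto intro!: permutes_compose permutes_swap_id simp: j'_def[symmetric])
  then show thesis by (rule that)
qed

text \<open>The same double counting over ordered pairs of distinct points, on which the symmetric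
  group is transitive. Such a sum is the full double sum minus its diagonal, and both of these are
  computed separately.\<close>

lemma sum_permutations_eq_two:
  fixes f :: "'a \<Rightarrow> 'a \<Rightarrow> 'b::comm_ring_1"
  assumes A: "finite A" and ij: "i \<in> A" "j \<in> A" "i \<noteq> j"
  shows "of_nat (card A) * (of_nat (card A) - 1) * (\<Sum>\<sigma>\<in>{\<sigma>. \<sigma> permutes A}. f (\<sigma> i) (\<sigma> j))
       = of_nat (fact (card A)) * ((\<Sum>p\<in>A. \<Sum>q\<in>A. f p q) - (\<Sum>p\<in>A. f p p))"
proof -
  define S where "S p q = (\<Sum>\<sigma>\<in>{\<sigma>. \<sigma> permutes A}. f (\<sigma> p) (\<sigma> q))" for p q
  have inv: "S p q = S i j" if pq: "p \<in> A" "q \<in> A" "p \<noteq> q" for p q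
  proof -
    obtain \<tau> where "\<tau> permutes A" "\<tau> i = p" "\<tau> j = q"
      using permutes_two_points[OF ij(1,2) pq(1,2) ij(3) pq(3)] .
    then show ?thesis
      using sum_permutations_compose_right[of \<tau> A "\<lambda>\<sigma>. f (\<sigma> i) (\<sigma> j)"] by (simp add: S_def)
  qed
  have "(\<Sum>p\<in>A. \<Sum>q\<in>A. S p q) - (\<Sum>p\<in>A. S p p) = (\<Sum>p\<in>A. \<Sum>q\<in>A - {p}. S p q)"
    using A by (simp add: sum_subtractf[symmetric] sum_diff1)
  also have "\<dots> = (\<Sum>p\<in>A. \<Sum>q\<in>A - {p}. S i j)"
    by (intro sum.cong refl inv) auto
  also have "\<dots> = of_nat (card A) * (of_nat (card A) - 1) * S i j"
  proof -
    \<comment> \<open>This reconciles the natural number \<open>card A - 1\<close>, the size of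
      \<open>A - {p}\<close>, with the ring difference \<open>of_nat (card A) - 1\<close>.\<close>
    obtain m where "card A = Suc m" using A ij by (cases "card A") auto
    then show ?thesis using A by (simp add: mult.assoc)
  qed
  finally have "of_nat (card A) * (of_nat (card A) - 1) * S i j
      = (\<Sum>p\<in>A. \<Sum>q\<in>A. S p q) - (\<Sum>p\<in>A. S p p)" ..
  moreover have "(\<Sum>p\<in>A. \<Sum>q\<in>A. S p q) = of_nat (fact (card A)) * (\<Sum>p\<in>A. \<Sum>q\<in>A. f p q)"
  proof -
    have "(\<Sum>p\<in>A. \<Sum>q\<in>A. S p q) = (\<Sum>\<sigma>\<in>{\<sigma>. \<sigma> permutes A}. \<Sum>p\<in>A. \<Sum>q\<in>A. f (\<sigma> p) (\<sigma> q))"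
      unfolding S_def by (rule sym, subst sum.swap, intro sum.cong refl, rule sum.swap)
    also have "\<dots> = (\<Sum>\<sigma>\<in>{\<sigma>. \<sigma> permutes A}. \<Sum>p\<in>A. \<Sum>q\<in>A. f p q)"
    proof (rule sum.cong[OF refl])
      fix \<sigma> assume "\<sigma> \<in> {\<sigma>. \<sigma> permutes A}"
      then have s: "\<sigma> permutes A" by simp
      have "(\<Sum>p\<in>A. \<Sum>q\<in>A. f (\<sigma> p) (\<sigma> q)) = (\<Sum>p\<in>A. \<Sum>q\<in>A. f (\<sigma> p) q)"
        using sum.permute[OF s, of "f (\<sigma> _)"] by (simp add: comp_def)
      also have "\<dots> = (\<Sum>p\<in>A. \<Sum>q\<in>A. f p q)"
        using sum.permute[OF s, of "\<lambda>p. \<Sum>q\<in>A. f p q"] by (simp add: comp_def)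
      finally show "(\<Sum>p\<in>A. \<Sum>q\<in>A. f (\<sigma> p) (\<sigma> q)) = (\<Sum>p\<in>A. \<Sum>q\<in>A. f p q)" .
    qed
    finally show ?thesis using A by (simp add: card_permutations)
  qed
  moreover have "(\<Sum>p\<in>A. S p p) = of_nat (fact (card A)) * (\<Sum>p\<in>A. f p p)"
  proof -
    have "(\<Sum>p\<in>A. S p p) = (\<Sum>p\<in>A. S i i)"
      using sum_permutations_compose_right[OF permutes_swap_id[OF ij(1)], of _ "\<lambda>\<sigma>. f (\<sigma> i) (\<sigma> i)"]
      by (intro sum.cong refl) (simp add: S_def)
    then show ?thesis
      using sum_permutations_eq_one[OF A ij(1), of "\<lambda>p. f p p"] by (simp add: S_def)
  qed
  ultimately show ?thesis by (simp add: S_def algebra_simps)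
qed

text \<open>Row i of \<open>perm_mat N \<sigma>\<close> has its only 1 in the column that \<sigma>
  sends to i, so the inverse permutation appears.\<close>

lemma index_conj_by_perm_mat:
  assumes s: "\<sigma> permutes {..<N}" and A: "A \<in> carrier_mat N N" and ij: "i < N" "j < N"
  shows "conj_by (perm_mat N \<sigma>) A $$ (i, j) = A $$ (Hilbert_Choice.inv \<sigma> i, Hilbert_Choice.inv \<sigma> j)"
proof -
  have eq: "i = \<sigma> p \<longleftrightarrow> p = Hilbert_Choice.inv \<sigma> i" for i p
    using permutes_inverses[OF s] by metis
  have lt: "Hilbert_Choice.inv \<sigma> i < N" "Hilbert_Choice.inv \<sigma> j < N"
    using permutes_in_image[OF permutes_inv[OF s]] ij by auto
  have "conj_by (perm_mat N \<sigma>) A $$ (i, j)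
      = (\<Sum>p<N. \<Sum>q<N. perm_mat N \<sigma> $$ (i, p) * A $$ (p, q) * cnj (perm_mat N \<sigma> $$ (j, q)))"
    using A ij by (intro index_conj_by) (auto simp: perm_mat_def)
  also have "\<dots> = (\<Sum>p<N. \<Sum>q<N. if q = Hilbert_Choice.inv \<sigma> j then if p = Hilbert_Choice.inv \<sigma> i then A $$ (p, q) else 0 else 0)"
    using ij by (intro sum.cong refl) (auto simp: perm_mat_def eq)
  also have "\<dots> = A $$ (Hilbert_Choice.inv \<sigma> i, Hilbert_Choice.inv \<sigma> j)" using lt by simp
  finally show ?thesis .
qed

lemma card_Sym: "card (Sym N) = fact N"
  by (simp add: Sym_def card_permutations)

lemma finite_Sym: "finite (Sym N)"
  by (simp add: Sym_def finite_permutations)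

lemma twirl_eq_mexp: "twirl N A = mexp N N (Sym N) (\<lambda>\<sigma>. conj_by (perm_mat N \<sigma>) A)"
  by (simp add: twirl_def mexp_def card_Sym)

text \<open>Inversion is a bijection of the symmetric group, so the inverses disappear after
  summation.\<close>

lemma twirl_index:
  assumes "A \<in> carrier_mat N N" "i < N" "j < N"
  shows "twirl N A $$ (i, j) = (\<Sum>\<sigma>\<in>{\<sigma>. \<sigma> permutes {..<N}}. A $$ (\<sigma> i, \<sigma> j)) / of_nat (fact N)"
proof -
  have "(\<Sum>\<sigma>\<in>Sym N. conj_by (perm_mat N \<sigma>) A $$ (i, j))
      = (\<Sum>\<sigma>\<in>{\<sigma>. \<sigma> permutes {..<N}}. A $$ (Hilbert_Choice.inv \<sigma> i, Hilbert_Choice.inv \<sigma> j))"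
    unfolding Sym_def using assms by (intro sum.cong refl) (auto simp: index_conj_by_perm_mat)
  also have "\<dots> = (\<Sum>\<sigma>\<in>{\<sigma>. \<sigma> permutes {..<N}}. A $$ (\<sigma> i, \<sigma> j))"
    by (rule sum_permutations_inverse[symmetric])
  finally show ?thesis using assms by (simp add: twirl_eq_mexp card_Sym)
qed

text \<open>For a square matrix this is the quadratic form of A at the all-ones vector, which every
  permutation matrix fixes.\<close>

definition entry_sum :: "complex mat \<Rightarrow> complex" where
  "entry_sum A = (\<Sum>i<dim_row A. \<Sum>j<dim_col A. A $$ (i, j))"

text \<open>The twirl commutes with all permutation matrices, so it has constant diagonal and constant
  off-diagonal entries; both constants are read off from the trace and the sum of all entries,
  which are preserved.\<close>
lemma twirl_eq:
  assumes A: "A \<in> carrier_mat N N" and N: "N \<ge> 2"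
    and b: "b = (entry_sum A - mtrace A) / (of_nat N * (of_nat N - 1))"
  shows "twirl N A = (mtrace A / of_nat N - b) \<cdot>\<^sub>m 1\<^sub>m N + b \<cdot>\<^sub>m all_ones N"
proof (rule eq_matI)
  fix i j assume "i < dim_row ((mtrace A / of_nat N - b) \<cdot>\<^sub>m 1\<^sub>m N + b \<cdot>\<^sub>m all_ones N)"
    "j < dim_col ((mtrace A / of_nat N - b) \<cdot>\<^sub>m 1\<^sub>m N + b \<cdot>\<^sub>m all_ones N)"
  then have ij: "i < N" "j < N" by (auto simp: all_ones_def)
  have N0: "of_nat N \<noteq> (0 :: complex)" "of_nat N - 1 \<noteq> (0 :: complex)" "of_nat (fact N) \<noteq> (0 :: complex)"
    using N by auto
  show "twirl N A $$ (i, j) = ((mtrace A / of_nat N - b) \<cdot>\<^sub>m 1\<^sub>m N + b \<cdot>\<^sub>m all_ones N) $$ (i, j)"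
  proof (cases "i = j")
    case True
    have "of_nat N * (\<Sum>\<sigma>\<in>{\<sigma>. \<sigma> permutes {..<N}}. A $$ (\<sigma> i, \<sigma> i)) = of_nat (fact N) * mtrace A"
      using sum_permutations_eq_one[of "{..<N}" i "\<lambda>p. A $$ (p, p)"] ij A by (simp add: mtrace_def)
    then show ?thesis
      using True ij N0 A by (simp add: twirl_index all_ones_def field_simps)
  next
    case False
    have "of_nat N * (of_nat N - 1) * (\<Sum>\<sigma>\<in>{\<sigma>. \<sigma> permutes {..<N}}. A $$ (\<sigma> i, \<sigma> j))
        = of_nat (fact N) * (entry_sum A - mtrace A)"
      using sum_permutations_eq_two[of "{..<N}" i j "\<lambda>p q. A $$ (p, q)"] ij A False
      by (simp add: mtrace_def entry_sum_def)
    then have "(\<Sum>\<sigma>\<in>{\<sigma>. \<sigma> permutes {..<N}}. A $$ (\<sigma> i, \<sigma> j)) = of_nat (fact N) * b"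
      using N0 by (simp add: b nonzero_eq_divide_eq mult.commute)
    then show ?thesis
      using False ij N0 A by (simp add: twirl_index all_ones_def)
  qed
qed (auto simp: twirl_eq_mexp all_ones_def)

section \<open>Spectrum and trace norm of aI + bJ\<close>

lemma eigvals_upper_triangular:
  assumes "A \<in> carrier_mat n n" "upper_triangular A"
  shows "eigvals A = mset (diag_mat A)"
proof -
  have "proots (\<Prod>a\<leftarrow>xs. [:- a, 1:]) = mset xs" for xs :: "complex list"
  proof (induction xs)
    case (Cons x xs)
    have "(\<Prod>a\<leftarrow>xs. [:- a, 1:]) \<noteq> 0" by (auto simp: prod_list_zero_iff)
    then have "proots ([:- x, 1:] * (\<Prod>a\<leftarrow>xs. [:- a, 1:])) = {#x#} + mset xs"
      using Cons by (subst proots_mult) auto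
    then show ?case by simp
  qed simp
  then show ?thesis
    unfolding eigvals_def char_poly_upper_triangular[OF assms] .
qed

text \<open>In the basis consisting of the all-ones vector and all unit vectors but the first, the
  all-ones matrix vanishes outside its first row.\<close>
lemma eigvals_scalar_plus_all_ones:
  assumes n: "n > 0"
  shows "eigvals (a \<cdot>\<^sub>m 1\<^sub>m n + b \<cdot>\<^sub>m all_ones n)
       = add_mset (a + of_nat n * b) (replicate_mset (n - 1) a)"
proof -
  define A where "A = a \<cdot>\<^sub>m 1\<^sub>m n + b \<cdot>\<^sub>m all_ones n"
  define P :: "complex mat" where
    "P = mat n n (\<lambda>(i, j). (if j = i then 1 else 0) + (if j = 0 then if i = 0 then 0 else 1 else 0))"
  \<comment> \<open>The inverse of \<open>P\<close>: left multiplication by \<open>P\<close> adds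
    row 0 to every other row, by \<open>Q\<close> subtracts it. Both are the identity plus a partial
    column 0, so that products split into two sums with a single surviving term.\<close>
  define Q :: "complex mat" where
    "Q = mat n n (\<lambda>(i, j). (if j = i then 1 else 0) + (if j = 0 then if i = 0 then 0 else - 1 else 0))"
  \<comment> \<open>The matrix of \<open>A\<close> in the new basis: J maps the all-ones vector to n
    times itself and each unit vector to the all-ones vector.\<close>
  define B :: "complex mat" where
    "B = mat n n (\<lambda>(i, j). (if i = j then a else 0)
                          + (if i = 0 then b * (if j = 0 then of_nat n else 1) else 0))"
  have A: "A \<in> carrier_mat n n" and P: "P \<in> carrier_mat n n" and Q: "Q \<in> carrier_mat n n"
    and B: "B \<in> carrier_mat n n"
    by (auto simp: A_def P_def Q_def B_def all_ones_def)
  have P_index: "P $$ (i, j) = (if j = i then 1 else 0) + (if j = 0 then if i = 0 then 0 else 1 else 0)"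
    and Q_index: "Q $$ (i, j) = (if j = i then 1 else 0) + (if j = 0 then if i = 0 then 0 else - 1 else 0)"
    if "i < n" "j < n" for i j
    using that by (simp_all add: P_def Q_def)
  have PX: "(P * X) $$ (i, j) = X $$ (i, j) + (if i = 0 then 0 else X $$ (0, j))"
    if X: "X \<in> carrier_mat n n" and ij: "i < n" "j < n" for X i j
  proof -
    have "(P * X) $$ (i, j) = (\<Sum>k<n. (if k = i then X $$ (k, j) else 0)
        + (if k = 0 then if i = 0 then 0 else X $$ (k, j) else 0))"
      unfolding index_mult_mat_sum[OF P X ij] using ij by (intro sum.cong refl) (auto simp: P_def)
    then show ?thesis using ij n by (simp add: sum.distrib)
  qed
  have QX: "(Q * X) $$ (i, j) = X $$ (i, j) - (if i = 0 then 0 else X $$ (0, j))"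
    if X: "X \<in> carrier_mat n n" and ij: "i < n" "j < n" for X i j
  proof -
    have "(Q * X) $$ (i, j) = (\<Sum>k<n. (if k = i then X $$ (k, j) else 0)
        + (if k = 0 then if i = 0 then 0 else - X $$ (k, j) else 0))"
      unfolding index_mult_mat_sum[OF Q X ij] using ij by (intro sum.cong refl) (auto simp: Q_def)
    then show ?thesis using ij n by (simp add: sum.distrib)
  qed
  have PQ: "P * Q = 1\<^sub>m n"
    using P Q n by (intro eq_matI) (auto simp del: index_mult_mat(1) simp: PX[OF Q] Q_index)
  have QP: "Q * P = 1\<^sub>m n"
    using P Q n by (intro eq_matI) (auto simp del: index_mult_mat(1) simp: QX[OF P] P_index)
  have AP: "A * P = P * B"
  proof (rule eq_matI)
    fix i j assume "i < dim_row (P * B)" "j < dim_col (P * B)"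
    then have ij: "i < n" "j < n" using P B by auto
    have "(A * P) $$ (i, j) = (\<Sum>k<n. (if k = i then a * P $$ (k, j) else 0) + b * P $$ (k, j))"
      unfolding index_mult_mat_sum[OF A P ij] using ij
      by (intro sum.cong refl) (auto simp: A_def all_ones_def algebra_simps)
    also have "\<dots> = a * P $$ (i, j) + b * (\<Sum>k<n. P $$ (k, j))"
      using ij by (simp add: sum.distrib sum_distrib_left)
    \<comment> \<open>Every row of J P consists of the column sums of \<open>P\<close>.\<close>
    also have "(\<Sum>k<n. P $$ (k, j)) = (if j = 0 then of_nat n else 1)"
    proof (cases "j = 0")
      case True
      then have "(\<Sum>k<n. P $$ (k, j)) = (\<Sum>k<n. 1)"
        using ij by (intro sum.cong refl) (auto simp: P_def)
      then show ?thesis using True by simp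
    next
      case False
      then have "(\<Sum>k<n. P $$ (k, j)) = (\<Sum>k<n. if k = j then 1 else 0)"
        using ij by (intro sum.cong refl) (auto simp: P_def)
      then show ?thesis using False ij by simp
    qed
    finally show "(A * P) $$ (i, j) = (P * B) $$ (i, j)"
      unfolding PX[OF B ij] using ij n by (auto simp: P_def B_def)
  qed (use A P B in auto)
  have "A = A * (P * Q)" using A PQ by simp
  also have "\<dots> = P * B * Q"
    unfolding assoc_mult_mat[OF A P Q, symmetric] AP ..
  finally have "similar_mat A B"
    by (rule similar_matI[OF _ PQ QP, rotated]) (use A B P Q in auto)
  then have "eigvals A = eigvals B"
    by (simp add: eigvals_def char_poly_similar)
  also have "\<dots> = mset (diag_mat B)"
    by (rule eigvals_upper_triangular[OF B]) (auto simp: B_def)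
  also have "diag_mat B = (a + of_nat n * b) # replicate (n - 1) a"
    using n by (intro nth_equalityI) (auto simp: diag_mat_def B_def nth_Cons' mult.commute)
  finally show ?thesis by (simp add: A_def)
qed

text \<open>For real coefficients the matrix is self-adjoint, and its square has the same shape
  because J^2 = nJ. The eigenvalues of the square are (a + nb)^2 and a^2, whose square roots are the
  absolute values.\<close>

lemma trace_norm_scalar_plus_all_ones:
  fixes a b :: real
  assumes n: "n > 0"
  shows "trace_norm (complex_of_real a \<cdot>\<^sub>m 1\<^sub>m n + complex_of_real b \<cdot>\<^sub>m all_ones n)
       = \<bar>a + real n * b\<bar> + real (n - 1) * \<bar>a\<bar>"
proof -
  define A where "A = complex_of_real a \<cdot>\<^sub>m 1\<^sub>m n + complex_of_real b \<cdot>\<^sub>m all_ones n"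
  have A: "A \<in> carrier_mat n n" by (auto simp: A_def all_ones_def)
  have A_index: "A $$ (i, j) = (if i = j then of_real a else 0) + of_real b" if "i < n" "j < n" for i j
    using that by (simp add: A_def all_ones_def)
  have adj: "mat_adjoint A = A"
    using A by (intro eq_matI) (auto simp: A_index)
  have "A * A = complex_of_real (a\<^sup>2) \<cdot>\<^sub>m 1\<^sub>m n + complex_of_real (2 * a * b + real n * b\<^sup>2) \<cdot>\<^sub>m all_ones n"
    (is "_ = ?B")
  proof (rule eq_matI)
    fix i j assume "i < dim_row ?B" "j < dim_col ?B"
    then have ij: "i < n" "j < n" by (auto simp: all_ones_def)
    have "(A * A) $$ (i, j) = (\<Sum>k<n. (if k = i then of_real a * A $$ (k, j) else 0)
        + ((if k = j then of_real (a * b) else 0) + of_real (b * b)))"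
      unfolding index_mult_mat_sum[OF A A ij] using ij
      by (intro sum.cong refl) (auto simp: A_index algebra_simps)
    also have "\<dots> = of_real a * A $$ (i, j) + of_real (a * b) + of_nat n * of_real (b * b)"
      using ij by (simp add: sum.distrib)
    finally show "(A * A) $$ (i, j) = ?B $$ (i, j)"
      using ij by (simp add: A_index all_ones_def power2_eq_square algebra_simps)
  qed (use A in \<open>auto simp: all_ones_def\<close>)
  then have "eigvals (mat_adjoint A * A) = add_mset (complex_of_real (a\<^sup>2)
      + of_nat n * complex_of_real (2 * a * b + real n * b\<^sup>2)) (replicate_mset (n - 1) (complex_of_real (a\<^sup>2)))"
    unfolding adj using eigvals_scalar_plus_all_ones[OF n] by simp
  also have "complex_of_real (a\<^sup>2) + of_nat n * complex_of_real (2 * a * b + real n * b\<^sup>2)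
      = complex_of_real ((a + real n * b)\<^sup>2)"
    by (simp add: power2_eq_square algebra_simps)
  finally show ?thesis
    unfolding trace_norm_def A_def[symmetric] by simp
qed

section \<open>The isometry V and the entry sums of block matrices\<close>

lemma isoV_carrier:
  assumes "d2 \<le> d1"
  shows "isoV d1 d2 \<in> carrier_mat (2 ^ d1) (2 ^ d2)"
  using assms by (auto simp: isoV_def kron_def ket0_def simp flip: power_add)

text \<open>The appended zero qubits are the least significant ones, so basis index j is shifted to
  j 2^(d1 - d2).\<close>

lemma isoV_index:
  assumes d: "d2 \<le> d1" and ij: "i < 2 ^ d1" "j < 2 ^ d2"
  shows "isoV d1 d2 $$ (i, j) = (if i = j * 2 ^ (d1 - d2) then 1 else 0)"
proof -
  let ?m = "2 ^ (d1 - d2) :: nat"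
  have i: "i < 2 ^ d2 * ?m" using ij d by (simp flip: power_add)
  then have "i div ?m < 2 ^ d2" by (simp add: less_mult_imp_div_less)
  moreover have "i = j * ?m \<longleftrightarrow> i div ?m = j \<and> i mod ?m = 0"
    by (auto simp: mult.commute)
  ultimately show ?thesis
    using i ij by (auto simp: isoV_def kron_def ket0_def)
qed

text \<open>The entry sum of V times its adjoint is the sum over the columns of V of the squared
  modulus of the column sum. There are 2^d2 columns, each with sum 1.\<close>

lemma entry_sum_isoV:
  assumes d: "d2 \<le> d1"
  shows "entry_sum (isoV d1 d2 * mat_adjoint (isoV d1 d2)) = 2 ^ d2"
proof -
  let ?V = "isoV d1 d2"
  have V: "?V \<in> carrier_mat (2 ^ d1) (2 ^ d2)" by (rule isoV_carrier[OF d])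
  then have V': "mat_adjoint ?V \<in> carrier_mat (2 ^ d2) (2 ^ d1)" by auto
  have col: "(\<Sum>i<2 ^ d1. ?V $$ (i, p)) = 1" if p: "p < 2 ^ d2" for p
  proof -
    have "p * 2 ^ (d1 - d2) < 2 ^ d2 * 2 ^ (d1 - d2)" using p by simp
    then have "p * 2 ^ (d1 - d2) < 2 ^ d1" using d by (simp flip: power_add)
    then show ?thesis using p by (simp add: isoV_index[OF d])
  qed
  have "entry_sum (?V * mat_adjoint ?V)
      = (\<Sum>i<2 ^ d1. \<Sum>j<2 ^ d1. \<Sum>p<2 ^ d2. ?V $$ (i, p) * cnj (?V $$ (j, p)))"
    using V V' by (auto simp: entry_sum_def index_mult_mat_sum[OF V V'] simp del: index_mult_mat(1)
        intro!: sum.cong)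
  also have "\<dots> = (\<Sum>p<2 ^ d2. \<Sum>i<2 ^ d1. \<Sum>j<2 ^ d1. ?V $$ (i, p) * cnj (?V $$ (j, p)))"
    by (simp add: sum.swap[of _ "{..<2 ^ d2}"])
  also have "\<dots> = (\<Sum>p<2 ^ d2. (\<Sum>i<2 ^ d1. ?V $$ (i, p)) * cnj (\<Sum>j<2 ^ d1. ?V $$ (j, p)))"
    by (simp add: sum_product)
  also have "\<dots> = (\<Sum>p<(2::nat) ^ d2. 1)" using col by (intro sum.cong refl) simp
  finally show ?thesis by simp
qed

lemma entry_sum_adjoint: "entry_sum (mat_adjoint A) = cnj (entry_sum A)"
  by (simp add: entry_sum_def sum.swap[of _ "{..<dim_row A}"])

lemma entry_sum_smult: "entry_sum (c \<cdot>\<^sub>m A) = c * entry_sum A"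
  by (simp add: entry_sum_def sum_distrib_left)

lemma entry_sum_one: "entry_sum (1\<^sub>m n) = of_nat n"
  by (simp add: entry_sum_def)

lemma mtrace_scalar: "mtrace (c \<cdot>\<^sub>m 1\<^sub>m n) = c * of_nat n"
  by (simp add: mtrace_def)

lemma sum_lessThan_add:
  fixes f :: "nat \<Rightarrow> 'a::comm_monoid_add"
  shows "(\<Sum>i<m + n. f i) = (\<Sum>i<m. f i) + (\<Sum>i<n. f (m + i))"
  by (induction n) (simp_all add: add.assoc)

lemma mtrace_Ma1:
  assumes "A \<in> carrier_mat n n" "B \<in> carrier_mat n n"
  shows "mtrace (Ma1 \<eta> A B) = mtrace A"
  using assms by (simp add: mtrace_def Ma1_def sum_lessThan_add sum.distrib flip: sum_divide_distrib)

lemma entry_sum_Ma1: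
  assumes "A \<in> carrier_mat n n" "B \<in> carrier_mat n n"
  shows "entry_sum (Ma1 \<eta> A B) = entry_sum A + (entry_sum B + cnj (entry_sum B)) / of_nat \<eta>"
proof -
  have "entry_sum (Ma1 \<eta> A B) = entry_sum ((1/2) \<cdot>\<^sub>m A) + entry_sum ((1 / of_nat \<eta>) \<cdot>\<^sub>m B)
     + (entry_sum ((1 / of_nat \<eta>) \<cdot>\<^sub>m mat_adjoint B) + entry_sum ((1/2) \<cdot>\<^sub>m A))"
    using assms by (simp add: entry_sum_def Ma1_def sum_lessThan_add sum.distrib)
  then show ?thesis
    by (simp add: entry_sum_smult entry_sum_adjoint add_divide_distrib)
qed

section \<open>The averaged states\<close>

lemma mexp_Ma0:
  assumes "\<And>k. k \<in> K \<Longrightarrow> g k \<in> carrier_mat n n"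
  shows "mexp (n + n) (n + n) K (\<lambda>k. Ma0 (g k)) = Ma0 (mexp n n K g)"
proof (rule eq_matI)
  fix i j assume "i < dim_row (Ma0 (mexp n n K g))" "j < dim_col (Ma0 (mexp n n K g))"
  then have ij: "i < n + n" "j < n + n" by (auto simp: Ma0_def)
  have Ma0_index: "Ma0 A $$ (i, j) = (if i < n then if j < n then A $$ (i, j) / 2 else 0
      else if j < n then 0 else A $$ (i - n, j - n) / 2)" if "A \<in> carrier_mat n n" for A
    using that ij by (auto simp: Ma0_def)
  show "mexp (n + n) (n + n) K (\<lambda>k. Ma0 (g k)) $$ (i, j) = Ma0 (mexp n n K g) $$ (i, j)"
    using ij assms by (simp add: Ma0_index sum_divide_distrib[symmetric])
qed (auto simp: Ma0_def)

lemma Ma0_scalar: "Ma0 (c \<cdot>\<^sub>m 1\<^sub>m n) = (c / 2) \<cdot>\<^sub>m 1\<^sub>m (n + n)"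
  by (rule eq_matI) (auto simp: Ma0_def)

text \<open>A scalar matrix has entry sum equal to its trace, so the off-diagonal constant is
  0.\<close>

lemma twirl_scalar:
  assumes "N \<ge> 2"
  shows "twirl N (c \<cdot>\<^sub>m 1\<^sub>m N) = c \<cdot>\<^sub>m 1\<^sub>m N"
proof -
  have "twirl N (c \<cdot>\<^sub>m 1\<^sub>m N) = (c - 0) \<cdot>\<^sub>m 1\<^sub>m N + 0 \<cdot>\<^sub>m all_ones N"
    using twirl_eq[of "c \<cdot>\<^sub>m 1\<^sub>m N" N 0] assms by (simp add: entry_sum_smult entry_sum_one mtrace_scalar)
  also have "\<dots> = c \<cdot>\<^sub>m 1\<^sub>m N" by (rule eq_matI) (auto simp: all_ones_def)
  finally show ?thesis .
qed

lemma mexp_Mo_key: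
  assumes "density_matrix (2 ^ d) Mo"
  shows "mexp (2 ^ d) (2 ^ d) (keys d) (Mo_key Mo) = (1 / 2 ^ d) \<cdot>\<^sub>m 1\<^sub>m (2 ^ d)"
  using pauli_twirl[of Mo d] assms by (simp add: density_matrix_def Mo_key_def[abs_def])

lemma mexp_Mc_key:
  assumes Mc: "density_matrix (2 ^ d2) Mc" and d: "d2 \<le> d1"
  shows "mexp (2 ^ d1) (2 ^ d1) (keys d2) (Mc_key d1 d2 Mc)
       = (1 / 2 ^ d2) \<cdot>\<^sub>m (isoV d1 d2 * mat_adjoint (isoV d1 d2))"
proof -
  note V = isoV_carrier[OF d]
  have "mexp (2 ^ d1) (2 ^ d1) (keys d2) (Mc_key d1 d2 Mc)
      = conj_by (isoV d1 d2) (mexp (2 ^ d2) (2 ^ d2) (keys d2) (Mo_key Mc))"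
    \<comment> \<open>The inner conjugation is folded into \<open>Mo_key Mc\<close>, so the key
      average for d2 qubits applies before V does.\<close>
    unfolding Mc_key_def[abs_def] Mo_key_def[symmetric]
    by (rule mexp_conj_by[OF V]) (auto simp: Mo_key_def keys_def intro!: conj_by_carrier pauli_key_carrier)
  also have "\<dots> = (1 / 2 ^ d2) \<cdot>\<^sub>m (isoV d1 d2 * mat_adjoint (isoV d1 d2))"
    unfolding mexp_Mo_key[OF Mc] conj_by_def mult_smult_distrib[OF V one_carrier_mat]
      right_mult_one_mat[OF V]
    using V by (intro mult_smult_assoc_mat) auto
  finally show ?thesis .
qed

text \<open>Neither \<open>Mo\<close> nor \<open>Mc\<close> occurs on the right-hand side; this
  independence gives (iv).\<close>

lemma twirl_Ma1_bar:
  assumes Mo: "density_matrix (2 ^ d1) Mo" and Mc: "density_matrix (2 ^ d2) Mc"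
    and d: "d2 \<le> d1" and N: "N = 2 ^ (d1 + 1)"
    and b: "b = (2 / real \<eta>) / (real N * (real N - 1))"
  shows "twirl N (Ma1_bar d1 d2 \<eta> Mo Mc)
       = complex_of_real (1 / real N - b) \<cdot>\<^sub>m 1\<^sub>m N + complex_of_real b \<cdot>\<^sub>m all_ones N"
proof -
  let ?A = "mexp (2 ^ d1) (2 ^ d1) (keys d1) (Mo_key Mo)"
  let ?B = "mexp (2 ^ d1) (2 ^ d1) (keys d2) (Mc_key d1 d2 Mc)"
  let ?\<Phi> = "Ma1_bar d1 d2 \<eta> Mo Mc"
  have N2: "N \<ge> 2" by (simp add: N)
  have "mtrace ?\<Phi> = mtrace ?A"
    unfolding Ma1_bar_def by (rule mtrace_Ma1) auto
  then have tr: "mtrace ?\<Phi> = 1"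
    by (simp add: mexp_Mo_key[OF Mo] mtrace_scalar)
  have "entry_sum ?A = 1" "entry_sum ?B = 1"
    by (simp_all add: mexp_Mo_key[OF Mo] entry_sum_one mexp_Mc_key[OF Mc d] entry_sum_smult
        entry_sum_isoV[OF d])
  then have es: "entry_sum ?\<Phi> = 1 + 2 / of_nat \<eta>"
    unfolding Ma1_bar_def by (subst entry_sum_Ma1[of _ "2 ^ d1"]) auto
  have \<Phi>: "?\<Phi> \<in> carrier_mat N N"
    by (auto simp: Ma1_bar_def Ma1_def N)
  have "complex_of_real b = (entry_sum ?\<Phi> - mtrace ?\<Phi>) / (of_nat N * (of_nat N - 1))"
    by (simp add: b es tr)
  from twirl_eq[OF \<Phi> N2 this] show ?thesis by (simp add: tr)
qed

text \<open>The key average is taken inside the permutation average. It is already scalar, and the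
  twirl fixes scalar matrices.\<close>

lemma mexp_Mf_Ma0:
  assumes Mo: "density_matrix (2 ^ d1) Mo" and N: "N = 2 ^ (d1 + 1)"
  shows "mexp N N (Sym N \<times> keys d1) (\<lambda>(\<sigma>, k). Mf N \<sigma> (Ma0 (Mo_key Mo k)))
       = (1 / 2 ^ (d1 + 1)) \<cdot>\<^sub>m 1\<^sub>m N"
proof -
  let ?n = "2 ^ d1 :: nat"
  have Nn: "N = ?n + ?n" by (simp add: N)
  have Mo_key: "Mo_key Mo k \<in> carrier_mat ?n ?n" if "k \<in> keys d1" for k
    using that by (auto simp: Mo_key_def keys_def intro!: conj_by_carrier pauli_key_carrier)
  then have Ma0_carrier: "Ma0 (Mo_key Mo k) \<in> carrier_mat N N" if "k \<in> keys d1" for k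
    using that unfolding Nn Ma0_def by (intro four_block_carrier_mat) auto
  have "mexp N N (keys d1) (\<lambda>k. Ma0 (Mo_key Mo k)) = Ma0 (mexp ?n ?n (keys d1) (Mo_key Mo))"
    unfolding Nn by (rule mexp_Ma0) (rule Mo_key)
  also have "\<dots> = (1 / 2 ^ (d1 + 1)) \<cdot>\<^sub>m 1\<^sub>m N"
    unfolding mexp_Mo_key[OF Mo] Ma0_scalar Nn by (simp add: mult.commute)
  finally have key: "mexp N N (keys d1) (\<lambda>k. Ma0 (Mo_key Mo k)) = (1 / 2 ^ (d1 + 1)) \<cdot>\<^sub>m 1\<^sub>m N" .
  have "mexp N N (Sym N \<times> keys d1) (\<lambda>(\<sigma>, k). Mf N \<sigma> (Ma0 (Mo_key Mo k)))
      = mexp N N (Sym N) (\<lambda>\<sigma>. mexp N N (keys d1) (\<lambda>k. conj_by (perm_mat N \<sigma>) (Ma0 (Mo_key Mo k))))"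
    unfolding Mf_def by (rule mexp_Times[OF finite_Sym finite_keys])
  also have "\<dots> = mexp N N (Sym N) (\<lambda>\<sigma>. conj_by (perm_mat N \<sigma>) (mexp N N (keys d1) (\<lambda>k. Ma0 (Mo_key Mo k))))"
    by (intro mexp_cong mexp_conj_by Ma0_carrier) (auto simp: perm_mat_def)
  also have "\<dots> = twirl N ((1 / 2 ^ (d1 + 1)) \<cdot>\<^sub>m 1\<^sub>m N)"
    unfolding key twirl_eq_mexp ..
  also have "\<dots> = (1 / 2 ^ (d1 + 1)) \<cdot>\<^sub>m 1\<^sub>m N"
    by (rule twirl_scalar) (simp add: N)
  finally show ?thesis .
qed

section \<open>Trace distances and the final statement\<close>

text \<open>The zero matrix is the case a = b = 0 of aI + bJ, so its trace norm is already
  known.\<close>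

lemma trace_dist_self:
  assumes A: "A \<in> carrier_mat n n" and n: "n > 0"
  shows "trace_dist A A = 0"
proof -
  have "A - A = complex_of_real 0 \<cdot>\<^sub>m 1\<^sub>m n + complex_of_real 0 \<cdot>\<^sub>m all_ones n"
    using A by (intro eq_matI) (auto simp: all_ones_def)
  then show ?thesis
    unfolding trace_dist_def using trace_norm_scalar_plus_all_ones[OF n, of 0 0] by simp
qed

lemma trace_dist_to_maximally_mixed:
  fixes b :: real
  assumes N: "N \<ge> 2" and b: "b \<ge> 0"
  shows "trace_dist (complex_of_real (1 / real N - b) \<cdot>\<^sub>m 1\<^sub>m N + complex_of_real b \<cdot>\<^sub>m all_ones N)
           ((1 / of_nat N) \<cdot>\<^sub>m 1\<^sub>m N) = (real N - 1) * b"
proof -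
  have diff: "complex_of_real (1 / real N - b) \<cdot>\<^sub>m 1\<^sub>m N + complex_of_real b \<cdot>\<^sub>m all_ones N
      - (1 / of_nat N) \<cdot>\<^sub>m 1\<^sub>m N
      = complex_of_real (- b) \<cdot>\<^sub>m 1\<^sub>m N + complex_of_real b \<cdot>\<^sub>m all_ones N"
    by (rule eq_matI) (auto simp: all_ones_def)
  have "- b + real N * b = (real N - 1) * b" by (simp add: algebra_simps)
  moreover have "real (N - 1) = real N - 1" "(real N - 1) * b \<ge> 0" using N b by auto
  moreover have "\<bar>- b\<bar> = b" using b by simp
  moreover have "N > 0" using N by simp
  ultimately show ?thesis
    unfolding trace_dist_def diff by (simp only: trace_norm_scalar_plus_all_ones) simp
qed

theorem theorem13:
  fixes d1 d2 \<eta> :: nat and \<epsilon> :: real and Mo Mc :: "complex mat"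
  defines "N \<equiv> 2 ^ (d1 + 1)"
  assumes d: "d1 \<ge> d2" "d2 \<ge> 1"
    and eta: "\<eta> > 0" and eps: "\<epsilon> > 0"
    and Mo: "density_matrix (2 ^ d1) Mo" "strictly_pos_def (2 ^ d1) Mo"
    and Mc: "density_matrix (2 ^ d2) Mc"
    and standing: "standing_assm d1 d2 \<eta> \<epsilon> Mo Mc"
  shows
    "mexp N N (Sym N \<times> keys d1) (\<lambda>(\<sigma>, k). Mf N \<sigma> (Ma0 (Mo_key Mo k)))
       = (1 / 2 ^ (d1 + 1)) \<cdot>\<^sub>m 1\<^sub>m N
     \<and> mexp (2^d1) (2^d1) (keys d1) (Mo_key Mo) = (1 / 2 ^ d1) \<cdot>\<^sub>m 1\<^sub>m (2 ^ d1)
     \<and> mexp (2^d1) (2^d1) (keys d2) (Mc_key d1 d2 Mc)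
         = (1 / 2 ^ d2) \<cdot>\<^sub>m (isoV d1 d2 * mat_adjoint (isoV d1 d2))
     \<and> twirl N (Ma1_bar d1 d2 \<eta> Mo Mc)
         = complex_of_real ((2 ^ (d1 + 1) - 1 - 2 / real \<eta>) / (2 ^ (d1 + 1) * (2 ^ (d1 + 1) - 1)))
             \<cdot>\<^sub>m 1\<^sub>m N
           + complex_of_real ((2 / real \<eta>) / (2 ^ (d1 + 1) * (2 ^ (d1 + 1) - 1))) \<cdot>\<^sub>m all_ones N
     \<and> trace_dist (twirl N (Ma1_bar d1 d2 \<eta> Mo Mc))
                  (mexp N N (Sym N \<times> keys d1) (\<lambda>(\<sigma>, k). Mf N \<sigma> (Ma0 (Mo_key Mo k))))
         = 1 / (real \<eta> * 2 ^ d1)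
     \<and> 1 / (real \<eta> * 2 ^ d1) < \<epsilon>
     \<and> (\<forall>Mo2 Mc2. density_matrix (2 ^ d1) Mo2 \<and> strictly_pos_def (2 ^ d1) Mo2
           \<and> density_matrix (2 ^ d2) Mc2 \<longrightarrow>
           trace_dist (twirl N (Ma1_bar d1 d2 \<eta> Mo Mc)) (twirl N (Ma1_bar d1 d2 \<eta> Mo2 Mc2)) = 0)"
proof -
  have N: "N = 2 ^ (d1 + 1)" by (simp add: N_def)
  have N2: "N \<ge> 2" and N_real: "real N = 2 ^ (d1 + 1)" by (simp_all add: N)
  define b where "b = (2 / real \<eta>) / (real N * (real N - 1))"
  note i = mexp_Mf_Ma0[OF Mo(1) N]
  note twirl = twirl_Ma1_bar[OF Mo(1) Mc d(1) N b_def]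
  have pos: "real N > 1" using N2 by simp
  have b0: "b \<ge> 0" using pos by (simp add: b_def)
  \<comment> \<open>Over this common denominator the stated coefficient of I splits as 1/N -
    b.\<close>
  have "1 / real N = (real N - 1) / (real N * (real N - 1))" using pos by simp
  then have a: "(real N - 1 - 2 / real \<eta>) / (real N * (real N - 1)) = 1 / real N - b"
    by (simp only: b_def diff_divide_distrib)
  have ii: "twirl N (Ma1_bar d1 d2 \<eta> Mo Mc)
         = complex_of_real ((2 ^ (d1 + 1) - 1 - 2 / real \<eta>) / (2 ^ (d1 + 1) * (2 ^ (d1 + 1) - 1)))
             \<cdot>\<^sub>m 1\<^sub>m N
           + complex_of_real ((2 / real \<eta>) / (2 ^ (d1 + 1) * (2 ^ (d1 + 1) - 1))) \<cdot>\<^sub>m all_ones N"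
    unfolding N_real[symmetric] a b_def[symmetric] by (rule twirl)
  have mixed: "(1 / 2 ^ (d1 + 1)) \<cdot>\<^sub>m 1\<^sub>m N = (1 / of_nat N :: complex) \<cdot>\<^sub>m 1\<^sub>m N" by (simp add: N)
  have "trace_dist (twirl N (Ma1_bar d1 d2 \<eta> Mo Mc))
      (mexp N N (Sym N \<times> keys d1) (\<lambda>(\<sigma>, k). Mf N \<sigma> (Ma0 (Mo_key Mo k)))) = (real N - 1) * b"
    unfolding i twirl mixed by (rule trace_dist_to_maximally_mixed[OF N2 b0])
  also have "\<dots> = 2 / (real \<eta> * real N)"
    using pos eta by (simp add: b_def divide_simps)
  also have "\<dots> = 1 / (real \<eta> * 2 ^ d1)" by (simp add: N)
  finally have iii: "trace_dist (twirl N (Ma1_bar d1 d2 \<eta> Mo Mc))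
      (mexp N N (Sym N \<times> keys d1) (\<lambda>(\<sigma>, k). Mf N \<sigma> (Ma0 (Mo_key Mo k)))) = 1 / (real \<eta> * 2 ^ d1)" .
  \<comment> \<open>Since 2^d1 is at least 1, the bound 1/\<eta> < \<epsilon> of the standing
    assumption suffices.\<close>
  have "1 / (real \<eta> * 2 ^ d1) \<le> 1 / real \<eta>"
    using eta by (intro divide_left_mono) auto
  also have "\<dots> < \<epsilon>" using standing by (simp add: standing_assm_def)
  finally have lt: "1 / (real \<eta> * 2 ^ d1) < \<epsilon>" .
  have iv: "trace_dist (twirl N (Ma1_bar d1 d2 \<eta> Mo Mc)) (twirl N (Ma1_bar d1 d2 \<eta> Mo2 Mc2)) = 0"
    if "density_matrix (2 ^ d1) Mo2" "density_matrix (2 ^ d2) Mc2" for Mo2 Mc2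
    unfolding twirl twirl_Ma1_bar[OF that d(1) N b_def] using N2
    by (intro trace_dist_self[of _ N]) (auto simp: all_ones_def)
  show ?thesis
    by (intro conjI allI impI i mexp_Mo_key[OF Mo(1)] mexp_Mc_key[OF Mc d(1)] ii iii lt iv) auto
qed

end
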